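(* Let $g\ge2$ be an integer, let $k>2(g+1)$ be a fixed even integer and $s_0\in\mathbb{C}$. For $f\in E(g,k,s_0)$ we have $$\frac{D'_f(s_0)}{D_f(s_0)}+\frac{D'_f(k-s_0)}{D_f(k-s_0)}=2g\log 2\pi-\sum_{\nu=0}^{g-1}\psi\left(s_0-\frac{\nu}{2}\right)-\sum_{\nu=0}^{g-1}\psi\left(k-s_0-\frac{\nu}{2}\right).$$ Furthermore, if $k\ge2(g+7)$, then for any $s_0=k/2+a/b\in\mathbb{Q}$ with $0\le a/b<(g+1)/2$ (and $f\in E(g,k,s_0)$) we have $$\frac{D'_f(s_0)}{D_f(s_0)}+\frac{D'_f(k-s_0)}{D_f(k-s_0)}\neq0.$$
   Context: $\psi=\Gamma'/\Gamma$ is the digamma function; $\log 2\pi$ means $\log(2\pi)$. For an integer $g\ge2$, $\mathrm{Sp}_g(\mathbb{Z})$ is the full Siegel modular group of genus $g$ and $\Lambda_g^+$ the set of positive definite (symmetric) half-integral matrices of size $g$. For an even integer $k$, let $f$ be a Siegel cusp form of weight $k$ for $\mathrm{Sp}_g(\mathbb{Z})$ with Fourier coefficients $a(T)$, $T\in\Lambda_g^+$. The Koecher-Maass series of $f$ is $$D_f(s)=\sum_{T\in\Lambda_g^+/\mathrm{GL}_g(\mathbb{Z})}\frac{a(T)}{\epsilon(T)}(\det T)^{-s}\qquad(\Re(s)\gg1),$$ where $\mathrm{GL}_g(\mathbb{Z})$ acts by $T\mapsto U^tTU$ and $\epsilon(T)=\#\{U\in\mathrm{GL}_g(\mathbb{Z}):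 U^tTU=T\}$. The completed series $D_f^*(s)=(2\pi)^{-gs}\prod_{\nu=0}^{g-1}\Gamma(s-\nu/2)D_f(s)$ has a holomorphic continuation to $\mathbb{C}$ and satisfies $D_f^*(k-s)=(-1)^{gk/2}D_f^*(s)$; $D_f(s)$ is continued accordingly. $E(g,k,s_0)$ is the set of all Siegel Hecke eigen cusp forms $f$ of weight $k$ for $\mathrm{Sp}_g(\mathbb{Z})$ such that $D_f(s_0)\neq0$. It is understood that $s_0$ is such that the left-hand side is defined, i.e. $D_f(k-s_0)\neq0$. *)

theory Defs
  imports "HOL-Complex_Analysis.Complex_Analysis"
begin

text \<open>
  The genus is \<open>g = CARD('g)\<close>. Elements of \<open>Sp\<^sub>g(\<int>)\<close> and, more generally, integral symplectic
  similitudes are square integer matrices indexed by \<open>'g + 'g\<close>; the summands \<open>Inl\<close> and \<open>Inr\<close>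
  cut such a matrix into its four \<open>g \<times> g\<close> blocks.
\<close>

definition pos_def :: "real^'g^'g \<Rightarrow> bool" where
  "pos_def Y \<longleftrightarrow> transpose Y = Y \<and> (\<forall>x. x \<noteq> 0 \<longrightarrow> x \<bullet> (Y *v x) > 0)"

definition siegel_half_space :: "(complex^'g^'g) set" where
  "siegel_half_space = {Z. transpose Z = Z \<and> pos_def (map_matrix Im Z)}"

definition symplectic_J :: "int^('g::finite + 'g)^('g + 'g)" where
  "symplectic_J = (\<chi> r c. case (r, c) of
      (Inl i, Inr j) \<Rightarrow> (if i = j then 1 else 0)
    | (Inr i, Inl j) \<Rightarrow> (if i = j then -1 else 0)
    | _ \<Rightarrow> 0)"

definition symplectic_similitudes :: "int \<Rightarrow> (int^('g::finite + 'g)^('g + 'g)) set" where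
  "symplectic_similitudes n =
     {M. transpose M ** symplectic_J ** M = mat n ** symplectic_J}"

definition Sp_Z :: "(int^('g::finite + 'g)^('g + 'g)) set" where
  "Sp_Z = {M. transpose M ** symplectic_J ** M = symplectic_J}"

definition block_A :: "int^('g::finite + 'g)^('g + 'g) \<Rightarrow> complex^'g^'g" where
  "block_A M = (\<chi> i j. of_int (M $ Inl i $ Inl j))"

definition block_B :: "int^('g::finite + 'g)^('g + 'g) \<Rightarrow> complex^'g^'g" where
  "block_B M = (\<chi> i j. of_int (M $ Inl i $ Inr j))"

definition block_C :: "int^('g::finite + 'g)^('g + 'g) \<Rightarrow> complex^'g^'g" where
  "block_C M = (\<chi> i j. of_int (M $ Inr i $ Inl j))"

definition block_D :: "int^('g::finite + 'g)^('g + 'g) \<Rightarrow> complex^'g^'g" where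
  "block_D M = (\<chi> i j. of_int (M $ Inr i $ Inr j))"

definition automorphy_matrix ::
    "int^('g::finite + 'g)^('g + 'g) \<Rightarrow> complex^'g^'g \<Rightarrow> complex^'g^'g" where
  "automorphy_matrix M Z = block_C M ** Z + block_D M"

definition siegel_action ::
    "int^('g::finite + 'g)^('g + 'g) \<Rightarrow> complex^'g^'g \<Rightarrow> complex^'g^'g" where
  "siegel_action M Z = (block_A M ** Z + block_B M) ** matrix_inv (automorphy_matrix M Z)"

text \<open>
  For a similitude \<open>M\<close> of multiplier \<open>n\<close> the usual slash operator carries in addition a power of
  \<open>n\<close>. It is omitted: it only rescales the Hecke operators below, hence their eigenvalues.
\<close>

definition siegel_slash ::
    "nat \<Rightarrow> int^('g::finite + 'g)^('g + 'g) \<Rightarrow> (complex^'g^'g \<Rightarrow> complex)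
      \<Rightarrow> complex^'g^'g \<Rightarrow> complex" where
  "siegel_slash k M F Z = inverse (det (automorphy_matrix M Z) ^ k) * F (siegel_action M Z)"

text \<open>
  Holomorphy on the Siegel half space, an open subset of the complex vector space of symmetric
  matrices: existence of a complex-linear Frechet derivative. The product \<open>mat c ** W\<close> is the
  scalar multiple of \<open>W\<close> by \<open>c\<close>. Since the derivative is taken within symmetric matrices, the
  values of \<open>L\<close> off that subspace are irrelevant, and any complex-linear extension will do.
\<close>

definition siegel_holomorphic :: "(complex^'g^'g \<Rightarrow> complex) \<Rightarrow> bool" where
  "siegel_holomorphic F \<longleftrightarrow>
     (\<forall>Z\<in>siegel_half_space. \<exists>L. (F has_derivative L) (at Z within siegel_half_space) \<and>
        (\<forall>c W. L (mat c ** W) = c * L W))"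

definition half_integral :: "(real^'g^'g) set" where
  "half_integral =
     {T. transpose T = T \<and> (\<forall>i. T $ i $ i \<in> \<int>) \<and> (\<forall>i j. 2 * T $ i $ j \<in> \<int>)}"

definition Lambda_plus :: "(real^'g^'g) set" where
  "Lambda_plus = {T \<in> half_integral. pos_def T}"

definition siegel_fourier_expansion ::
    "(complex^'g^'g \<Rightarrow> complex) \<Rightarrow> (real^'g^'g \<Rightarrow> complex) \<Rightarrow> bool" where
  "siegel_fourier_expansion F a \<longleftrightarrow>
     (\<forall>Z\<in>siegel_half_space.
        ((\<lambda>T. a T * exp (2 * of_real pi * \<i> * trace (map_matrix of_real T ** Z)))
          has_sum F Z) half_integral)"

text \<open>The coefficients are uniquely determined on \<^const>\<open>half_integral\<close>, and only used there.\<close>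

definition siegel_fourier_coeff :: "(complex^'g^'g \<Rightarrow> complex) \<Rightarrow> real^'g^'g \<Rightarrow> complex" where
  "siegel_fourier_coeff F = (SOME a. siegel_fourier_expansion F a)"

text \<open>
  In genus at least 2 no growth condition is needed (Koecher principle). Only the values on
  \<^const>\<open>siegel_half_space\<close> of a form matter.
\<close>

definition siegel_modular_form :: "nat \<Rightarrow> (complex^'g^'g \<Rightarrow> complex) \<Rightarrow> bool" where
  "siegel_modular_form k F \<longleftrightarrow> siegel_holomorphic F \<and>
     (\<forall>M\<in>Sp_Z. \<forall>Z\<in>siegel_half_space. siegel_slash k M F Z = F Z)"

definition siegel_cusp_form :: "nat \<Rightarrow> (complex^'g^'g \<Rightarrow> complex) \<Rightarrow> bool" where
  "siegel_cusp_form k F \<longleftrightarrow> siegel_modular_form k F \<and>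
     (\<exists>a. siegel_fourier_expansion F a) \<and>
     (\<forall>T\<in>half_integral. siegel_fourier_coeff F T \<noteq> 0 \<longrightarrow> pos_def T)"

text \<open>
  The Hecke operator of the double coset of \<open>M\<close>: the sum of the slash operators over
  representatives of the finitely many cosets \<open>Sp\<^sub>g(\<int>) N\<close> contained in it. On modular forms of
  weight \<open>k\<close> the choice of representatives is irrelevant.
\<close>

definition double_coset ::
    "int^('g::finite + 'g)^('g + 'g) \<Rightarrow> (int^('g + 'g)^('g + 'g)) set" where
  "double_coset M = {P ** M ** Q | P Q. P \<in> Sp_Z \<and> Q \<in> Sp_Z}"

definition left_cosets ::
    "int^('g::finite + 'g)^('g + 'g) \<Rightarrow> (int^('g + 'g)^('g + 'g)) set set" where
  "left_cosets M = (\<lambda>N. {P ** N | P. P \<in> Sp_Z}) ` double_coset M"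

definition hecke_operator ::
    "nat \<Rightarrow> int^('g::finite + 'g)^('g + 'g) \<Rightarrow> (complex^'g^'g \<Rightarrow> complex)
      \<Rightarrow> complex^'g^'g \<Rightarrow> complex" where
  "hecke_operator k M F Z = (\<Sum>C\<in>left_cosets M. siegel_slash k (SOME N. N \<in> C) F Z)"

definition hecke_eigen_cusp_form :: "nat \<Rightarrow> (complex^'g^'g \<Rightarrow> complex) \<Rightarrow> bool" where
  "hecke_eigen_cusp_form k F \<longleftrightarrow> siegel_cusp_form k F \<and>
     (\<exists>Z\<in>siegel_half_space. F Z \<noteq> 0) \<and>
     (\<forall>n>0. \<forall>M\<in>symplectic_similitudes n. \<exists>\<mu>. \<forall>Z\<in>siegel_half_space.
        hecke_operator k M F Z = \<mu> * F Z)"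

text \<open>Over the integers \<^const>\<open>invertible\<close> means having an integral inverse.\<close>

definition GL_Z :: "(int^'g^'g) set" where
  "GL_Z = {U. invertible U}"

definition GL_act :: "int^'g^'g \<Rightarrow> real^'g^'g \<Rightarrow> real^'g^'g" where
  "GL_act U T = transpose (map_matrix of_int U) ** T ** map_matrix of_int U"

definition unit_count :: "real^'g^'g \<Rightarrow> nat" where
  "unit_count T = card {U \<in> GL_Z. GL_act U T = T}"

definition Lambda_plus_classes :: "(real^'g^'g) set set" where
  "Lambda_plus_classes = (\<lambda>T. (\<lambda>U. GL_act U T) ` GL_Z) ` Lambda_plus"

definition koecher_maass_term ::
    "(complex^'g^'g \<Rightarrow> complex) \<Rightarrow> complex \<Rightarrow> real^'g^'g \<Rightarrow> complex" where
  "koecher_maass_term F s T =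
     siegel_fourier_coeff F T / of_nat (unit_count T) * of_real (det T) powr (- s)"

text \<open>
  The summand is a class function when \<open>F\<close> has even weight, since then \<open>a(U\<^sup>tTU) = a(T)\<close>.
\<close>

definition koecher_maass_converges :: "(complex^'g^'g \<Rightarrow> complex) \<Rightarrow> complex \<Rightarrow> bool" where
  "koecher_maass_converges F s \<longleftrightarrow>
     (\<lambda>C. koecher_maass_term F s (SOME T. T \<in> C)) summable_on Lambda_plus_classes"

definition koecher_maass_series :: "(complex^'g^'g \<Rightarrow> complex) \<Rightarrow> complex \<Rightarrow> complex" where
  "koecher_maass_series F s =
     (\<Sum>\<^sub>\<infinity>C\<in>Lambda_plus_classes. koecher_maass_term F s (SOME T. T \<in> C))"

definition is_completed_koecher_maass ::
    "(complex^'g^'g \<Rightarrow> complex) \<Rightarrow> (complex \<Rightarrow> complex) \<Rightarrow> bool" where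
  "is_completed_koecher_maass F h \<longleftrightarrow> h holomorphic_on UNIV \<and>
     (\<exists>\<sigma>. \<forall>s. Re s > \<sigma> \<longrightarrow> koecher_maass_converges F s \<and>
        h s = of_real (2 * pi) powr (- (of_nat CARD('g) * s)) *
              (\<Prod>\<nu><CARD('g). Gamma (s - of_nat \<nu> / 2)) * koecher_maass_series F s)"

definition completed_koecher_maass :: "(complex^'g^'g \<Rightarrow> complex) \<Rightarrow> complex \<Rightarrow> complex" where
  "completed_koecher_maass F = (THE h. is_completed_koecher_maass F h)"

text \<open>
  The continued series. Dividing by the Gamma factors is written with the entire function
  \<^const>\<open>rGamma\<close> (the reciprocal of \<^const>\<open>Gamma\<close>), so that the value is also the right one at the
  poles of the Gamma factors.
\<close>

definition koecher_maass :: "(complex^'g^'g \<Rightarrow> complex) \<Rightarrow> complex \<Rightarrow> complex" where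
  "koecher_maass F s =
     of_real (2 * pi) powr (of_nat CARD('g) * s) *
     (\<Prod>\<nu><CARD('g). rGamma (s - of_nat \<nu> / 2)) * completed_koecher_maass F s"

definition E_set :: "nat \<Rightarrow> complex \<Rightarrow> (complex^'g^'g \<Rightarrow> complex) set" where
  "E_set k s\<^sub>0 = {F. hecke_eigen_cusp_form k F \<and> koecher_maass F s\<^sub>0 \<noteq> 0}"

end

theory Submission
  imports Defs
begin

text \<open>
  In the logarithmic derivative of \<open>D = (2\<pi>)\<^sup>g\<^sup>s \<Prod>\<^sub>\<nu> \<Gamma>(s - \<nu>/2)\<^sup>-\<^sup>1 D\<^sup>*\<close> the contributions of \<open>D\<^sup>*\<close> at \<open>s\<^sub>0\<close>
  and \<open>k - s\<^sub>0\<close> cancel by the functional equation, which leaves the elementary factors. For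
  \<open>k \<ge> 2(g + 7)\<close> all arguments of the digamma function exceed \<open>7\<close>, and \<open>\<psi>(7) = H\<^sub>6 - \<gamma> > log 2\<pi>\<close>, so
  that the right-hand side is negative.
\<close>

text \<open>Two completions agree on a right half-plane, hence everywhere by the identity theorem.
  So the \<open>THE\<close> in \<open>completed_koecher_maass\<close> denotes as soon as one
  completion exists.\<close>

lemma is_completed_koecher_maass_unique:
  assumes "is_completed_koecher_maass F h\<^sub>1" "is_completed_koecher_maass F h\<^sub>2"
  shows "h\<^sub>1 = h\<^sub>2"
proof
  fix z
  obtain \<sigma>\<^sub>1 \<sigma>\<^sub>2 where eq: "\<And>s. Re s > max \<sigma>\<^sub>1 \<sigma>\<^sub>2 \<Longrightarrow> h\<^sub>1 s = h\<^sub>2 s"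
    using assms unfolding is_completed_koecher_maass_def by (metis max_less_iff_conj)
  have "complex_of_real (max \<sigma>\<^sub>1 \<sigma>\<^sub>2 + 1) \<in> {s. Re s > max \<sigma>\<^sub>1 \<sigma>\<^sub>2}"
    unfolding mem_Collect_eq Re_complex_of_real by (rule less_add_one)
  then have "{s. Re s > max \<sigma>\<^sub>1 \<sigma>\<^sub>2} \<noteq> {}"
    by blast
  moreover have "h\<^sub>1 holomorphic_on UNIV" "h\<^sub>2 holomorphic_on UNIV"
    using assms by (simp_all add: is_completed_koecher_maass_def)
  moreover have "h\<^sub>1 s = h\<^sub>2 s" if "s \<in> {s. Re s > max \<sigma>\<^sub>1 \<sigma>\<^sub>2}" for s
    using that unfolding mem_Collect_eq by (rule eq)
  ultimately show "h\<^sub>1 z = h\<^sub>2 z"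
    by (rule analytic_continuation_open[OF open_halfspace_Re_gt open_UNIV _ connected_UNIV subset_UNIV]) simp_all
qed

lemma completed_koecher_maass_holomorphic:
  assumes "\<exists>h. is_completed_koecher_maass F h"
  shows "completed_koecher_maass F holomorphic_on UNIV"
proof -
  have "\<exists>!h. is_completed_koecher_maass F h"
    using assms is_completed_koecher_maass_unique by blast
  then have "is_completed_koecher_maass F (completed_koecher_maass F)"
    unfolding completed_koecher_maass_def by (rule theI')
  then show ?thesis
    by (simp add: is_completed_koecher_maass_def)
qed

text \<open>Both sides of the functional equation are differentiated: the inner map contributes the
  sign, and \<open>w\<close> cancels in the quotient. At a zero of \<open>h\<close> both quotients
  are 0, since division by 0 gives 0.\<close>

lemma logderiv_reflection:
  fixes h :: "complex \<Rightarrow> complex"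
  assumes "h holomorphic_on UNIV" and "\<And>s. h (c - s) = w * h s" and "w \<noteq> 0"
  shows "deriv h (c - s) / h (c - s) = - (deriv h s / h s)"
proof -
  have der: "(h has_field_derivative deriv h z) (at z)" for z
    using assms(1) by (intro holomorphic_derivI[of h UNIV]) auto
  have "((\<lambda>z. h (c - z)) has_field_derivative - deriv h (c - s)) (at s)"
    by (rule DERIV_chain2[OF der, THEN DERIV_cong]) (auto intro!: derivative_eq_intros)
  moreover have "((\<lambda>z. h (c - z)) has_field_derivative w * deriv h s) (at s)"
    unfolding assms(2) by (rule DERIV_cmult[OF der])
  ultimately have "- deriv h (c - s) = w * deriv h s"
    by (rule DERIV_unique)
  then have "deriv h (c - s) = - (w * deriv h s)"
    by (metis minus_minus)
  then show ?thesis
    using assms(2,3) by simp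
qed

text \<open>The logarithmic derivative turns the three factors (power of 2 pi, reciprocal Gammas,
  completed series) into three summands. A nonzero product has nonzero factors, so all three
  quotients are genuine.\<close>

lemma logderiv_koecher_maass:
  fixes F :: "complex^'g^'g \<Rightarrow> complex"
  assumes "\<exists>h. is_completed_koecher_maass F h" and "koecher_maass F s \<noteq> 0"
  shows "deriv (koecher_maass F) s / koecher_maass F s
    = of_nat CARD('g) * of_real (ln (2 * pi)) - (\<Sum>\<nu><CARD('g). Digamma (s - of_nat \<nu> / 2))
      + deriv (completed_koecher_maass F) s / completed_koecher_maass F s"
proof -
  define h where "h = completed_koecher_maass F"
  define A where "A = (\<lambda>z. of_real (2 * pi) powr (of_nat CARD('g) * z) :: complex)"
  define P where "P = (\<lambda>z::complex. \<Prod>\<nu><CARD('g). rGamma (z - of_nat \<nu> / 2))"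
  have eq: "koecher_maass F = (\<lambda>z. A z * P z * h z)"
    by (simp add: koecher_maass_def h_def A_def P_def fun_eq_iff)
  have nz: "A s \<noteq> 0" "P s \<noteq> 0" "h s \<noteq> 0"
    using assms(2) unfolding eq by auto
  \<comment> \<open>The zeros of \<open>rGamma\<close> are the poles of Gamma, so no digamma value
    below is taken at a pole.\<close>
  have rG: "rGamma (s - of_nat \<nu> / 2) \<noteq> 0" if "\<nu> < CARD('g)" for \<nu>
    using nz(2) that by (auto simp: P_def)
  have dh: "(h has_field_derivative deriv h s) (at s)"
    using completed_koecher_maass_holomorphic[OF assms(1)]
    by (intro holomorphic_derivI[of h UNIV]) (auto simp: h_def)
  \<comment> \<open>Differentiating \<open>powr\<close> produces the principal complex logarithm of
    the base, which is the real one as the base is positive.\<close>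
  have "Ln (complex_of_real (2 * pi)) = of_real (ln (2 * pi))"
    by (rule Ln_of_real) simp
  then have dA: "(A has_field_derivative A s * (of_nat CARD('g) * of_real (ln (2 * pi)))) (at s)"
    unfolding A_def
    by (intro DERIV_chain2[OF has_field_derivative_powr_right, THEN DERIV_cong])
       (auto intro!: derivative_eq_intros)
  have "((\<lambda>z. rGamma (z - of_nat \<nu> / 2)) has_field_derivative
          - rGamma (s - of_nat \<nu> / 2) * Digamma (s - of_nat \<nu> / 2)) (at s)"
    if "\<nu> < CARD('g)" for \<nu>
    using rG[OF that] unfolding rGamma_eq_zero_iff
    by (intro DERIV_chain2[OF has_field_derivative_rGamma_no_nonpos_int, THEN DERIV_cong])
       (auto intro!: derivative_eq_intros)
  then have "(P has_field_derivative P s * (\<Sum>\<nu><CARD('g).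
      - rGamma (s - of_nat \<nu> / 2) * Digamma (s - of_nat \<nu> / 2) / rGamma (s - of_nat \<nu> / 2))) (at s)"
    unfolding P_def using rG by (intro has_field_derivative_prod') auto
  also have "(\<Sum>\<nu><CARD('g).
      - rGamma (s - of_nat \<nu> / 2) * Digamma (s - of_nat \<nu> / 2) / rGamma (s - of_nat \<nu> / 2))
    = - (\<Sum>\<nu><CARD('g). Digamma (s - of_nat \<nu> / 2))"
    unfolding sum_negf[symmetric] using rG by (intro sum.cong) auto
  finally have dP: "(P has_field_derivative
      P s * - (\<Sum>\<nu><CARD('g). Digamma (s - of_nat \<nu> / 2))) (at s)" .
  have "deriv (koecher_maass F) s = koecher_maass F s *
      (of_nat CARD('g) * of_real (ln (2 * pi)) - (\<Sum>\<nu><CARD('g). Digamma (s - of_nat \<nu> / 2))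
        + deriv h s / h s)"
    unfolding eq using nz
    by (intro DERIV_imp_deriv DERIV_mult[OF DERIV_mult[OF dA dP] dh, THEN DERIV_cong])
       (simp add: algebra_simps)
  then show ?thesis
    using assms(2) by (simp add: h_def)
qed

text \<open>The argument 7 is the least integer that works: \<psi>(6) is about 1.71, log 2 pi about
  1.84 and \<psi>(7) about 1.87.\<close>

lemma ln_2pi_less_Digamma_7: "ln (2 * pi) < Digamma (7 :: real)"
proof -
  \<comment> \<open>A rational lower bound for \<psi>(7): 49/20 is the harmonic number
    \<open>harm 6\<close>, and 13/22 bounds Euler's constant from above.\<close>
  define x :: real where "x = 49 / 20 - 13 / 22"
  \<comment> \<open>The quadratic Taylor bound is too weak at \<open>x\<close> itself, and even at
    \<open>x / 4\<close> followed by a 4th power (about 6.12). At \<open>x / 8\<close> the 8th power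
    exceeds 6.3.\<close>
  have "1259 / 1000 \<le> 1 + x / 8 + (x / 8)\<^sup>2 / 2"
    by (simp add: x_def power2_eq_square)
  also have "\<dots> \<le> exp (x / 8)"
    by (rule exp_lower_Taylor_quadratic) (simp add: x_def)
  finally have e: "1259 / 1000 \<le> exp (x / 8)" .
  have "2 * pi < 63 / 10"
    using pi_approx(2) by simp
  also have "63 / 10 < (1259 / 1000 :: real) ^ 8"
    unfolding power_divide by simp
  also have "\<dots> \<le> exp (x / 8) ^ 8"
    using e by (rule power_mono) simp
  also have "\<dots> = exp x"
    using exp_of_nat_mult[of 8 "x / 8"] by simp
  finally have "2 * pi < exp x" .
  then have "ln (2 * pi) < ln (exp x)"
    by (rule ln_less_cancel_iff[THEN iffD2, rotated 2]) simp_all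
  then have "ln (2 * pi) < x"
    by (simp only: ln_exp)
  moreover have "Digamma (7 :: real) = harm 6 - euler_mascheroni"
    using Digamma_of_nat[of 6, where ?'a = real] by simp
  moreover have "harm 6 = (49 / 20 :: real)"
    by (simp add: harm_expand)
  ultimately show ?thesis
    using euler_mascheroni_less_13_over_22 by (simp add: x_def)
qed

theorem theorem18:
  fixes k :: nat and s\<^sub>0 :: complex and f :: "complex^'g^'g \<Rightarrow> complex"
  assumes genus: "CARD('g) \<ge> 2"
    and weight: "even k" "k > 2 * (CARD('g) + 1)"
    and f_in_E: "f \<in> E_set k s\<^sub>0"
    and continuation: "\<exists>h. is_completed_koecher_maass f h"
    and functional_equation:
      "\<forall>s. completed_koecher_maass f (of_nat k - s) =
           (-1) ^ (CARD('g) * k div 2) * completed_koecher_maass f s"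
    and defined_lhs: "koecher_maass f (of_nat k - s\<^sub>0) \<noteq> 0"
  shows "deriv (koecher_maass f) s\<^sub>0 / koecher_maass f s\<^sub>0
           + deriv (koecher_maass f) (of_nat k - s\<^sub>0) / koecher_maass f (of_nat k - s\<^sub>0)
         = 2 * of_nat CARD('g) * of_real (ln (2 * pi))
           - (\<Sum>\<nu><CARD('g). Digamma (s\<^sub>0 - of_nat \<nu> / 2))
           - (\<Sum>\<nu><CARD('g). Digamma (of_nat k - s\<^sub>0 - of_nat \<nu> / 2))
       \<and> (k \<ge> 2 * (CARD('g) + 7) \<longrightarrow>
           (\<forall>a b :: int. b \<noteq> 0 \<longrightarrow>
             0 \<le> (of_int a / of_int b :: real) \<longrightarrow>
             (of_int a / of_int b :: real) < (of_nat CARD('g) + 1) / 2 \<longrightarrow>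
             s\<^sub>0 = of_nat k / 2 + of_int a / of_int b \<longrightarrow>
             deriv (koecher_maass f) s\<^sub>0 / koecher_maass f s\<^sub>0
               + deriv (koecher_maass f) (of_nat k - s\<^sub>0) / koecher_maass f (of_nat k - s\<^sub>0) \<noteq> 0))"
proof (intro conjI impI allI)
  let ?h = "completed_koecher_maass f"
  have nz: "koecher_maass f s\<^sub>0 \<noteq> 0"
    using f_in_E by (simp add: E_set_def)
  \<comment> \<open>The sign in the functional equation plays the part of \<open>w\<close>; it does
    not affect the logarithmic derivative.\<close>
  have refl: "deriv ?h (of_nat k - s\<^sub>0) / ?h (of_nat k - s\<^sub>0) = - (deriv ?h s\<^sub>0 / ?h s\<^sub>0)"
    using functional_equation completed_koecher_maass_holomorphic[OF continuation]
    by (intro logderiv_reflection[where w = "(-1) ^ (CARD('g) * k div 2)"]) auto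
  show formula: "deriv (koecher_maass f) s\<^sub>0 / koecher_maass f s\<^sub>0
           + deriv (koecher_maass f) (of_nat k - s\<^sub>0) / koecher_maass f (of_nat k - s\<^sub>0)
         = 2 * of_nat CARD('g) * of_real (ln (2 * pi))
           - (\<Sum>\<nu><CARD('g). Digamma (s\<^sub>0 - of_nat \<nu> / 2))
           - (\<Sum>\<nu><CARD('g). Digamma (of_nat k - s\<^sub>0 - of_nat \<nu> / 2))"
    unfolding logderiv_koecher_maass[OF continuation nz]
      logderiv_koecher_maass[OF continuation defined_lhs] refl
    by (simp add: algebra_simps)

  fix a b :: int
  assume k: "k \<ge> 2 * (CARD('g) + 7)"
    and t: "0 \<le> (of_int a / of_int b :: real)" "(of_int a / of_int b :: real) < (of_nat CARD('g) + 1) / 2"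
    and s\<^sub>0: "s\<^sub>0 = of_nat k / 2 + of_int a / of_int b"
  define r :: real where "r = a / b"
  define x y :: "nat \<Rightarrow> real"
    where "x = (\<lambda>\<nu>. k / 2 + r - \<nu> / 2)" and "y = (\<lambda>\<nu>. k / 2 - r - \<nu> / 2)"
  \<comment> \<open>With k/2 \<ge> g + 7 and \<nu> \<le> g - 1, the bound r < (g + 1)/2 gives y > g
    + 7 - (g + 1)/2 - (g - 1)/2 = 7. This is where both numerical hypotheses are calibrated; for x,
    r \<ge> 0 leaves room to spare.\<close>
  have large: "x \<nu> > 7" "y \<nu> > 7" if "\<nu> < CARD('g)" for \<nu>
  proof -
    have \<nu>: "real \<nu> + 1 \<le> real CARD('g)"
      using that by linarith
    have k': "2 * real CARD('g) + 14 \<le> real k"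
      using of_nat_mono[OF k, where ?'a = real] by simp
    show "x \<nu> > 7"
      unfolding x_def using \<nu> k' t[folded r_def] by linarith
    show "y \<nu> > 7"
      unfolding y_def using \<nu> k' t[folded r_def] by (simp add: field_simps)
  qed
  have Digamma_large: "ln (2 * pi) < Digamma z" if "z > 7" for z :: real
    using ln_2pi_less_Digamma_7 Digamma_real_strict_mono[of 7 z] that by simp
  \<comment> \<open>Termwise strict inequalities yield a strict inequality of sums only over a
    nonempty index set.\<close>
  have "{..<CARD('g)} \<noteq> {}"
    using genus by (auto simp: lessThan_empty_iff)
  then have "(\<Sum>\<nu><CARD('g). ln (2 * pi)) < (\<Sum>\<nu><CARD('g). Digamma (x \<nu>))"
    and "(\<Sum>\<nu><CARD('g). ln (2 * pi)) < (\<Sum>\<nu><CARD('g). Digamma (y \<nu>))"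
    using large Digamma_large by (auto intro!: sum_strict_mono simp del: sum_constant)
  then have "2 * real CARD('g) * ln (2 * pi)
      - (\<Sum>\<nu><CARD('g). Digamma (x \<nu>)) - (\<Sum>\<nu><CARD('g). Digamma (y \<nu>)) \<noteq> 0"
    by simp
  then have nonzero: "complex_of_real (2 * real CARD('g) * ln (2 * pi)
      - (\<Sum>\<nu><CARD('g). Digamma (x \<nu>)) - (\<Sum>\<nu><CARD('g). Digamma (y \<nu>))) \<noteq> 0"
    unfolding of_real_eq_0_iff .
  \<comment> \<open>The arguments are real and exceed 7, so the complex digamma values are the real
    ones and the real estimate transfers.\<close>
  have real: "Digamma (s\<^sub>0 - of_nat \<nu> / 2) = of_real (Digamma (x \<nu>))"
    "Digamma (of_nat k - s\<^sub>0 - of_nat \<nu> / 2) = of_real (Digamma (y \<nu>))" if "\<nu> < CARD('g)" for \<nu>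
  proof -
    have "s\<^sub>0 - of_nat \<nu> / 2 = of_real (x \<nu>)" "of_nat k - s\<^sub>0 - of_nat \<nu> / 2 = of_real (y \<nu>)"
      unfolding s\<^sub>0 x_def y_def r_def by simp_all
    then show "Digamma (s\<^sub>0 - of_nat \<nu> / 2) = of_real (Digamma (x \<nu>))"
      "Digamma (of_nat k - s\<^sub>0 - of_nat \<nu> / 2) = of_real (Digamma (y \<nu>))"
      using large[OF that] by (simp_all add: Polygamma_of_real)
  qed
  show "deriv (koecher_maass f) s\<^sub>0 / koecher_maass f s\<^sub>0
      + deriv (koecher_maass f) (of_nat k - s\<^sub>0) / koecher_maass f (of_nat k - s\<^sub>0) \<noteq> 0"
    unfolding formula
    using nonzero by (simp add: real)
qed

end
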